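(* Let $(P,\gamma)$ be a labeled poset on a finite set $X$, and let $\psi:\mathcal E(P,\gamma)\to\mathbf W$ be the embedding $\psi(\sigma)=\sigma(x_1)\cdots\sigma(x_r)$, where $X=\{x_1,\dots,x_r\}$ is arranged so that $\gamma(x_1)>\gamma(x_2)>\cdots>\gamma(x_r)$. Then the image of $\mathcal E(P,\gamma)$ under $\psi$ together with $\{\mathbf 0\}$ is stable under $e_i,f_i$ for all $i\in I$. Hence $\mathcal E(P,\gamma)$ becomes a $\mathfrak{gl}_{\mathcal N}$-crystal.
   Context: $\mathcal N=\frac12\mathbb Z_{>0}$ with its usual linear order; elements of $\mathbb Z_{>0}$ are even, elements of $\frac12+\mathbb Z_{\ge0}$ are odd. $I=\frac12\mathbb Z_{>0}$. A labeled poset $(P,\gamma)$: $P=(X,<)$ is a finite set $X$ with a partial order, $\gamma:X\to\mathbb Z_{>0}$ an injective map. An enriched $(P,\gamma)$-partition is a map $\sigma:X\to\mathcal N$ such that for all $x<y$ in $P$: (1) $\sigma(x)\le\sigma(y)$; (2) $\sigma(x)=\sigma(y)\in\mathbb Z_{>0}$ implies $\gamma(x)<\gamma(y)$; (3) $\sigma(x)=\sigma(y)\in\frac12+\mathbb Z_{\ge0}$ implies $\gamma(x)>\gamma(y)$. $\mathcal E(P,\gamma)$ is the set of these. Weights: $\bigoplus_{b\in\mathcal N}\mathbb Z\epsilon_b$ is the weight lattice, with $(\epsilon_a,\epsilon_b)=(-1)^{|a|}\delta_{ab}$ ($|a|$ the parity), simple roots $\alpha_i=\epsilon_i-\epsilon_{i+\frac12}$,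 $i\in I$. A $\mathfrak{gl}_{\mathcal N}$-crystal is a set $B$ with maps $\mathrm{wt}:B\to\bigoplus\mathbb Z\epsilon_b$, $\varepsilon_i,\varphi_i:B\to\mathbb Z_{\ge0}$, $e_i,f_i:B\to B\cup\{\mathbf 0\}$ ($\mathbf 0$ a formal symbol) such that: (1) $\varphi_i(b)+\varepsilon_i(b)$ is $1$ if $(\mathrm{wt}(b),\alpha_i)\ne0$ and $0$ otherwise; (2) if $e_ib\in B$ then $\varepsilon_i(e_ib)=\varepsilon_i(b)-1$, $\varphi_i(e_ib)=\varphi_i(b)+1$, $\mathrm{wt}(e_ib)=\mathrm{wt}(b)+\alpha_i$; (3) if $f_ib\in B$ then $\varepsilon_i(f_ib)=\varepsilon_i(b)+1$, $\varphi_i(f_ib)=\varphi_i(b)-1$, $\mathrm{wt}(f_ib)=\mathrm{wt}(b)-\alpha_i$; (4) $f_ib=b'$ iff $b=e_ib'$. Crystal of words: $\mathbf W$ is the set of finite words in $\mathcal N$ (including the empty word), $\mathrm{wt}(w_1\cdots w_r)=\sum_k\epsilon_{w_k}$. On letters, $f_i(i)=i+\frac12$, $e_i(i+\frac12)=i$, all other $e_i,f_i$ give $\mathbf 0$. On $w=w_1\cdots w_r$: for $i\in\mathbb Z_{>0}$ (resp. $i\in\frac12+\mathbb Z_{\ge0}$) let $k$ be the smallest (resp. largest) index with $w_k\in\{i,i+\frac12\}$; $e_iw$, $f_iw$ are obtained by applying $e_i$, $f_i$ to $w_k$ ($\mathbf 0$ if that gives $\mathbf 0$); if no such $k$ exists,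 $e_iw=f_iw=\mathbf 0$. $\varepsilon_i(w)=1$ if $e_iw\neq\mathbf 0$, else $0$; $\varphi_i(w)=1$ if $f_iw\ne\mathbf 0$, else $0$. The crystal structure on $\mathcal E(P,\gamma)$ is the one transported via $\psi$ from $\mathbf W$. *)

theory Defs
  imports Complex_Main "HOL-Library.FuncSet" "HOL-Library.Poly_Mapping"
begin

section \<open>The alphabet of positive half-integers\<close>

text \<open>
  The alphabet \<open>NN\<close> is a set of rational numbers with the usual order. The index set \<open>I\<close>
  of the crystal operators is the same set.
\<close>

definition even_letters :: "rat set" where
  "even_letters = {of_nat n | n. n > 0}"

definition odd_letters :: "rat set" where
  "odd_letters = {1/2 + of_nat n | n. True}"

definition NN :: "rat set" where
  "NN = {of_nat n / 2 | n. n > 0}"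

lemma half_odd: "of_nat (2 * k + 1) / 2 = 1/2 + (of_nat k :: rat)"
  by (simp add: add_divide_distrib)

lemma NN_eq: "NN = even_letters \<union> odd_letters"
proof (intro equalityI subsetI)
  fix a assume "a \<in> NN"
  then obtain n :: nat where n: "a = of_nat n / 2" "n > 0" unfolding NN_def by blast
  show "a \<in> even_letters \<union> odd_letters"
  proof (cases "even n")
    case True
    then obtain k where "n = 2 * k" by blast
    with n have "a = of_nat k \<and> k > 0" by simp
    then show ?thesis unfolding even_letters_def by blast
  next
    case False
    then obtain k where "n = 2 * k + 1" by (rule oddE)
    with n have "a = 1/2 + of_nat k" by (simp only: half_odd)
    then show ?thesis unfolding odd_letters_def by blast
  qed
next
  fix a assume "a \<in> even_letters \<union> odd_letters"
  then show "a \<in> NN"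
  proof
    assume "a \<in> even_letters"
    then obtain n :: nat where "a = of_nat n" "n > 0" unfolding even_letters_def by blast
    then have "a = of_nat (2 * n) / 2 \<and> 2 * n > 0" by simp
    then show ?thesis unfolding NN_def by (intro CollectI exI[of _ "2 * n"])
  next
    assume "a \<in> odd_letters"
    then obtain n :: nat where "a = 1/2 + of_nat n" unfolding odd_letters_def by blast
    then have "a = of_nat (2 * n + 1) / 2 \<and> 2 * n + 1 > 0"
      by (simp only: half_odd) simp
    then show ?thesis unfolding NN_def by (intro CollectI exI[of _ "2 * n + 1"])
  qed
qed

section \<open>Labeled posets and enriched partitions\<close>

locale labeled_poset =
  fixes X :: "'a set" and lt :: "'a \<Rightarrow> 'a \<Rightarrow> bool" and \<gamma> :: "'a \<Rightarrow> nat"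
  assumes finite_carrier: "finite X"
    and irrefl: "irreflp_on X lt"
    and trans: "transp_on X lt"
    and label_pos: "\<forall>x\<in>X. \<gamma> x > 0"
    and label_inj: "inj_on \<gamma> X"

text \<open>Maps on \<open>X\<close> are extensional functions, so that they are determined by their values on \<open>X\<close>.\<close>

definition enriched_partitions ::
    "'a set \<Rightarrow> ('a \<Rightarrow> 'a \<Rightarrow> bool) \<Rightarrow> ('a \<Rightarrow> nat) \<Rightarrow> ('a \<Rightarrow> rat) set" where
  "enriched_partitions X lt \<gamma> = {\<sigma> \<in> X \<rightarrow>\<^sub>E NN. \<forall>x\<in>X. \<forall>y\<in>X. lt x y \<longrightarrow>
      \<sigma> x \<le> \<sigma> y \<and>
      (\<sigma> x = \<sigma> y \<and> \<sigma> x \<in> even_letters \<longrightarrow> \<gamma> x < \<gamma> y) \<and>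
      (\<sigma> x = \<sigma> y \<and> \<sigma> x \<in> odd_letters \<longrightarrow> \<gamma> x > \<gamma> y)}"

definition decreasing_arrangement :: "'a set \<Rightarrow> ('a \<Rightarrow> nat) \<Rightarrow> 'a list \<Rightarrow> bool" where
  "decreasing_arrangement X \<gamma> xs \<longleftrightarrow> set xs = X \<and> sorted_wrt (\<lambda>x y. \<gamma> x > \<gamma> y) xs"

lemma (in labeled_poset) ex_decreasing_arrangement: "\<exists>xs. decreasing_arrangement X \<gamma> xs"
proof -
  let ?ys = "sorted_list_of_set (\<gamma> ` X)" and ?g = "the_inv_into X \<gamma>"
  have ys: "set ?ys = \<gamma> ` X" "sorted_wrt (<) ?ys"
    using finite_carrier by simp_all
  have "sorted_wrt (\<lambda>m n. \<gamma> (?g m) < \<gamma> (?g n)) ?ys"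
    by (rule sorted_wrt_mono_rel[OF _ ys(2)])
      (simp add: ys(1) f_the_inv_into_f[OF label_inj])
  moreover have "set (map ?g ?ys) = X"
    using ys(1) label_inj by (simp add: the_inv_into_onto)
  ultimately have "decreasing_arrangement X \<gamma> (rev (map ?g ?ys))"
    by (simp add: decreasing_arrangement_def sorted_wrt_rev sorted_wrt_map)
  then show ?thesis ..
qed

definition psi :: "'a list \<Rightarrow> ('a \<Rightarrow> rat) \<Rightarrow> rat list" where
  "psi xs \<sigma> = map \<sigma> xs"

section \<open>Weights and crystals\<close>

definition eps :: "rat \<Rightarrow> rat \<Rightarrow>\<^sub>0 int" where
  "eps b = Poly_Mapping.single b 1"

definition weight_lattice :: "(rat \<Rightarrow>\<^sub>0 int) set" where
  "weight_lattice = {\<nu>. Poly_Mapping.keys \<nu> \<subseteq> NN}"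

definition parity :: "rat \<Rightarrow> nat" where
  "parity a = (if a \<in> even_letters then 0 else 1)"

text \<open>The bilinear form on the weight lattice determined by its values
  \<open>(\<epsilon>\<^sub>a, \<epsilon>\<^sub>b) = (-1)\<^sup>|\<^sup>a\<^sup>| \<delta>\<^sub>a\<^sub>b\<close> on the basis.\<close>

definition weight_form :: "(rat \<Rightarrow>\<^sub>0 int) \<Rightarrow> (rat \<Rightarrow>\<^sub>0 int) \<Rightarrow> int" where
  "weight_form \<nu> \<mu> = (\<Sum>a\<in>Poly_Mapping.keys \<nu>. \<Sum>b\<in>Poly_Mapping.keys \<mu>.
      Poly_Mapping.lookup \<nu> a * Poly_Mapping.lookup \<mu> b *
      (if a = b then (-1) ^ parity a else 0))"

definition simple_root :: "rat \<Rightarrow> rat \<Rightarrow>\<^sub>0 int" where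
  "simple_root i = eps i - eps (i + 1/2)"

text \<open>The formal symbol \<open>0\<close> adjoined to a crystal is \<^const>\<open>None\<close>.\<close>

locale gl_crystal =
  fixes B :: "'b set"
    and wt :: "'b \<Rightarrow> rat \<Rightarrow>\<^sub>0 int"
    and \<epsilon> \<phi> :: "rat \<Rightarrow> 'b \<Rightarrow> nat"
    and e f :: "rat \<Rightarrow> 'b \<Rightarrow> 'b option"
  assumes wt_closed: "b \<in> B \<Longrightarrow> wt b \<in> weight_lattice"
    and e_closed: "\<lbrakk>i \<in> NN; b \<in> B; e i b = Some b'\<rbrakk> \<Longrightarrow> b' \<in> B"
    and f_closed: "\<lbrakk>i \<in> NN; b \<in> B; f i b = Some b'\<rbrakk> \<Longrightarrow> b' \<in> B"
    and phi_plus_epsilon: "\<lbrakk>i \<in> NN; b \<in> B\<rbrakk> \<Longrightarrow>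
      \<phi> i b + \<epsilon> i b = (if weight_form (wt b) (simple_root i) \<noteq> 0 then 1 else 0)"
    and e_Some: "\<lbrakk>i \<in> NN; b \<in> B; e i b = Some b'\<rbrakk> \<Longrightarrow>
      int (\<epsilon> i b') = int (\<epsilon> i b) - 1 \<and> \<phi> i b' = \<phi> i b + 1 \<and> wt b' = wt b + simple_root i"
    and f_Some: "\<lbrakk>i \<in> NN; b \<in> B; f i b = Some b'\<rbrakk> \<Longrightarrow>
      \<epsilon> i b' = \<epsilon> i b + 1 \<and> int (\<phi> i b') = int (\<phi> i b) - 1 \<and> wt b' = wt b - simple_root i"
    and f_iff_e: "\<lbrakk>i \<in> NN; b \<in> B; b' \<in> B\<rbrakk> \<Longrightarrow> f i b = Some b' \<longleftrightarrow> e i b' = Some b"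

section \<open>The crystal of words\<close>

definition words :: "rat list set" where
  "words = lists NN"

definition word_wt :: "rat list \<Rightarrow> rat \<Rightarrow>\<^sub>0 int" where
  "word_wt w = (\<Sum>a\<leftarrow>w. eps a)"

definition letter_e :: "rat \<Rightarrow> rat \<Rightarrow> rat option" where
  "letter_e i a = (if a = i + 1/2 then Some i else None)"

definition letter_f :: "rat \<Rightarrow> rat \<Rightarrow> rat option" where
  "letter_f i a = (if a = i then Some (i + 1/2) else None)"

definition positions :: "rat \<Rightarrow> rat list \<Rightarrow> nat set" where
  "positions i w = {k. k < length w \<and> w ! k \<in> {i, i + 1/2}}"

definition word_op :: "(rat \<Rightarrow> rat \<Rightarrow> rat option) \<Rightarrow> rat \<Rightarrow> rat list \<Rightarrow> rat list option" where
  "word_op g i w =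
    (if positions i w = {} then None
     else let k = (if i \<in> even_letters then Min (positions i w) else Max (positions i w))
          in map_option (\<lambda>a. w[k := a]) (g i (w ! k)))"

definition word_e :: "rat \<Rightarrow> rat list \<Rightarrow> rat list option" where
  "word_e = word_op letter_e"

definition word_f :: "rat \<Rightarrow> rat list \<Rightarrow> rat list option" where
  "word_f = word_op letter_f"

definition word_epsilon :: "rat \<Rightarrow> rat list \<Rightarrow> nat" where
  "word_epsilon i w = (if word_e i w \<noteq> None then 1 else 0)"

definition word_phi :: "rat \<Rightarrow> rat list \<Rightarrow> nat" where
  "word_phi i w = (if word_f i w \<noteq> None then 1 else 0)"

section \<open>Transport along an embedding\<close>

text \<open>
  The operator \<open>g\<close> is pulled back along a map \<open>p\<close> that is injective on \<open>B\<close>. This is meaningful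
  when \<open>g b\<close> is \<^const>\<open>None\<close> or lies in the image of \<open>p\<close> for every \<open>b\<close> in the image of \<open>p\<close>.
\<close>

definition pullback_op :: "'b set \<Rightarrow> ('b \<Rightarrow> 'c) \<Rightarrow> ('c \<Rightarrow> 'c option) \<Rightarrow> 'b \<Rightarrow> 'b option" where
  "pullback_op B p g b = map_option (the_inv_into B p) (g (p b))"

end

theory Submission
  imports Defs
begin

text \<open>
  The operators \<open>e\<^sub>i\<close> and \<open>f\<^sub>i\<close> only move the letter at one pivot position within
  \<open>{i, i + 1/2}\<close>, and moving it does not change the pivot, so they are mutually inverse. Since the
  arrangement lists the labels in decreasing order, the pivot of \<open>\<psi> \<sigma>\<close> is the element of
  \<open>\<sigma>\<^sup>-\<^sup>1{i, i + 1/2}\<close> of largest label if \<open>i\<close> is even and of smallest label if \<open>i\<close> is odd. The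
  label conditions at the two adjacent values of opposite parity then force exactly those
  inequalities that are needed after the pivot has been moved. For the weights, \<open>i\<close> and
  \<open>i + 1/2\<close> have opposite parity, so \<open>(wt w, \<alpha>\<^sub>i)\<close> is up to sign the number of letters of \<open>w\<close>
  in \<open>{i, i + 1/2}\<close>; this gives the values of \<open>\<phi>\<^sub>i + \<epsilon>\<^sub>i\<close>.
\<close>

section \<open>Half-integers\<close>

lemma even_letters_half_iff:
  assumes "n > 0"
  shows "(of_nat n / 2 :: rat) \<in> even_letters \<longleftrightarrow> even n"
proof
  assume "(of_nat n / 2 :: rat) \<in> even_letters"
  then obtain m :: nat where "(of_nat n / 2 :: rat) = of_nat m" unfolding even_letters_def by blast
  then have "(of_nat n :: rat) = of_nat (2 * m)" by simp
  then have "n = 2 * m" by (simp only: of_nat_eq_iff)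
  then show "even n" by simp
next
  assume "even n"
  then obtain m where "n = 2 * m" by blast
  with assms show "(of_nat n / 2 :: rat) \<in> even_letters" unfolding even_letters_def by auto
qed

lemma odd_letters_eq: "odd_letters = NN - even_letters"
proof -
  have "a \<notin> even_letters" if "a \<in> odd_letters" for a
  proof -
    from that obtain n :: nat where "a = 1/2 + of_nat n" unfolding odd_letters_def by blast
    then have "a = of_nat (2 * n + 1) / 2" by (simp only: half_odd)
    moreover have "(of_nat (2 * n + 1) / 2 :: rat) \<notin> even_letters"
      by (subst even_letters_half_iff) auto
    ultimately show ?thesis by metis
  qed
  then show ?thesis unfolding NN_eq by blast
qed

lemma NN_add_half:
  assumes "i \<in> NN"
  shows "i + 1/2 \<in> NN" and "i + 1/2 \<in> even_letters \<longleftrightarrow> i \<notin> even_letters"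
proof -
  from assms obtain n :: nat where n: "i = of_nat n / 2" "n > 0" unfolding NN_def by blast
  then have i: "i + 1/2 = of_nat (Suc n) / 2" by (simp add: add_divide_distrib)
  then show "i + 1/2 \<in> NN" unfolding NN_def by blast
  show "i + 1/2 \<in> even_letters \<longleftrightarrow> i \<notin> even_letters"
    unfolding i by (subst even_letters_half_iff) (simp_all add: n even_letters_half_iff)
qed

text \<open>Discreteness of the alphabet: no letter lies strictly between \<open>i\<close> and
  \<open>i + 1/2\<close>, so a letter outside this pair compares in the same way with both of its
  members.\<close>

lemma NN_less_imp_add_half_le:
  assumes "a \<in> NN" "b \<in> NN" "a < b"
  shows "a + 1/2 \<le> b"
proof -
  obtain m n :: nat where mn: "a = of_nat m / 2" "b = of_nat n / 2"
    using assms(1,2) unfolding NN_def by blast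
  with assms(3) have "Suc m \<le> n" by simp
  then have "(of_nat (Suc m) :: rat) \<le> of_nat n" by (simp only: of_nat_le_iff)
  with mn show ?thesis by simp
qed

section \<open>The crystal of words\<close>

text \<open>The index \<open>k\<close> bound inside \<open>word_op\<close>. It is meaningful only
  when \<open>positions i w\<close> is nonempty, hence the guards in the lemmas below.\<close>

definition pivot :: "rat \<Rightarrow> rat list \<Rightarrow> nat" where
  "pivot i w = (if i \<in> even_letters then Min (positions i w) else Max (positions i w))"

lemma finite_positions: "finite (positions i w)"
  unfolding positions_def by simp

lemma pivot_in_positions: "positions i w \<noteq> {} \<Longrightarrow> pivot i w \<in> positions i w"
  unfolding pivot_def by (simp add: finite_positions)

lemma pivot_extremal:
  "k \<in> positions i w \<Longrightarrow> if i \<in> even_letters then pivot i w \<le> k else k \<le> pivot i w"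
  unfolding pivot_def by (simp add: finite_positions)

lemma positions_update:
  assumes "k \<in> positions i w" "c \<in> {i, i + 1/2}"
  shows "positions i (w[k := c]) = positions i w"
  using assms unfolding positions_def by (auto simp: nth_list_update)

lemma pivot_update:
  assumes "k \<in> positions i w" "c \<in> {i, i + 1/2}"
  shows "pivot i (w[k := c]) = pivot i w"
  unfolding pivot_def by (simp add: positions_update[OF assms])

lemma word_e_eq_Some_iff:
  "word_e i w = Some w' \<longleftrightarrow>
    positions i w \<noteq> {} \<and> w ! pivot i w = i + 1/2 \<and> w' = w[pivot i w := i]"
  unfolding word_e_def word_op_def letter_e_def pivot_def[symmetric] Let_def by auto

lemma word_f_eq_Some_iff:
  "word_f i w = Some w' \<longleftrightarrow>
    positions i w \<noteq> {} \<and> w ! pivot i w = i \<and> w' = w[pivot i w := i + 1/2]"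
  unfolding word_f_def word_op_def letter_f_def pivot_def[symmetric] Let_def by auto

lemma word_f_iff_word_e: "word_f i w = Some w' \<longleftrightarrow> word_e i w' = Some w"
proof
  assume "word_f i w = Some w'"
  then have *: "positions i w \<noteq> {}" "w ! pivot i w = i" "w' = w[pivot i w := i + 1/2]"
    by (auto simp: word_f_eq_Some_iff)
  from * have k: "pivot i w \<in> positions i w" "pivot i w < length w"
    using pivot_in_positions positions_def by auto
  then have "positions i w' = positions i w" "pivot i w' = pivot i w"
    using * k(1) by (simp_all add: positions_update pivot_update)
  \<comment> \<open>Writing \<open>i\<close> back at the pivot restores \<open>w\<close>, because
    \<open>w\<close> had the letter \<open>i\<close> there.\<close>
  then show "word_e i w' = Some w"
    using * k list_update_id[of w "pivot i w"] by (simp add: word_e_eq_Some_iff)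
next
  assume "word_e i w' = Some w"
  then have *: "positions i w' \<noteq> {}" "w' ! pivot i w' = i + 1/2" "w = w'[pivot i w' := i]"
    by (auto simp: word_e_eq_Some_iff)
  from * have k: "pivot i w' \<in> positions i w'" "pivot i w' < length w'"
    using pivot_in_positions positions_def by auto
  then have "positions i w = positions i w'" "pivot i w = pivot i w'"
    using * k(1) by (simp_all add: positions_update pivot_update)
  then show "word_f i w = Some w'"
    using * k list_update_id[of w' "pivot i w'"] by (simp add: word_f_eq_Some_iff)
qed

lemma word_phi_plus_epsilon:
  "word_phi i w + word_epsilon i w = (if positions i w \<noteq> {} then 1 else 0)"
proof (cases "positions i w = {}")
  case True
  then have "word_e i w = None" "word_f i w = None"
    unfolding word_e_def word_f_def word_op_def by simp_all
  then show ?thesis using True unfolding word_phi_def word_epsilon_def by simp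
next
  case False
  then have "w ! pivot i w \<in> {i, i + 1/2}"
    using pivot_in_positions[OF False] unfolding positions_def by simp
  then have "(word_e i w \<noteq> None) = (word_f i w = None)"
    using False unfolding word_e_def word_f_def word_op_def letter_e_def letter_f_def
      pivot_def[symmetric] Let_def by auto
  then show ?thesis using False unfolding word_phi_def word_epsilon_def by auto
qed

section \<open>Weights of words and their pairing with simple roots\<close>

lemma lookup_word_wt: "Poly_Mapping.lookup (word_wt w) b = int (count_list w b)"
  by (induction w) (auto simp: word_wt_def eps_def lookup_add lookup_single when_def)

lemma weight_form_simple_root:
  "weight_form \<nu> (simple_root i) =
    (-1) ^ parity i * Poly_Mapping.lookup \<nu> i
    - (-1) ^ parity (i + 1/2) * Poly_Mapping.lookup \<nu> (i + 1/2)"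
proof -
  have lookup: "Poly_Mapping.lookup (simple_root i) b =
      (if b = i then 1 else if b = i + 1/2 then -1 else 0)" for b
    unfolding simple_root_def eps_def lookup_minus lookup_single when_def by auto
  have keys: "Poly_Mapping.keys (simple_root i) = {i, i + 1/2}"
    by (auto simp: in_keys_iff lookup split: if_splits)
  \<comment> \<open>The form is diagonal, so for fixed \<open>b\<close> only \<open>a = b\<close>
    contributes; if \<open>b\<close> is not a key of \<nu>, both sides are 0. After the sums are
    swapped, \<open>c\<close> is the coefficient of the simple root at \<open>b\<close>.\<close>
  have row: "(\<Sum>a\<in>Poly_Mapping.keys \<nu>. Poly_Mapping.lookup \<nu> a * c *
      (if a = b then (-1) ^ parity a else 0)) = Poly_Mapping.lookup \<nu> b * c * (-1) ^ parity b" for b c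
  proof -
    have "(\<Sum>a\<in>Poly_Mapping.keys \<nu>. Poly_Mapping.lookup \<nu> a * c *
        (if a = b then (-1) ^ parity a else 0)) =
      (\<Sum>a\<in>Poly_Mapping.keys \<nu>. if a = b then Poly_Mapping.lookup \<nu> a * c * (-1) ^ parity a else 0)"
      by (rule sum.cong) auto
    then show ?thesis by (simp add: in_keys_iff)
  qed
  show ?thesis
    unfolding weight_form_def
    by (subst sum.swap) (simp add: keys row lookup)
qed

lemma positions_eq_empty_iff:
  "positions i w = {} \<longleftrightarrow> count_list w i = 0 \<and> count_list w (i + 1/2) = 0"
  unfolding positions_def count_list_0_iff in_set_conv_nth by auto

text \<open>Opposite parities turn the difference in \<open>weight_form_simple_root\<close> into
  plus or minus a sum of two letter counts, and counts cannot cancel.\<close>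

lemma weight_form_word_wt:
  assumes "i \<in> NN"
  shows "weight_form (word_wt w) (simple_root i) \<noteq> 0 \<longleftrightarrow> positions i w \<noteq> {}"
  unfolding weight_form_simple_root lookup_word_wt positions_eq_empty_iff
  using NN_add_half(2)[OF assms] by (auto simp: parity_def)

lemma word_wt_update:
  assumes "k < length w"
  shows "word_wt (w[k := c]) = word_wt w - eps (w ! k) + eps c"
  using assms unfolding word_wt_def
proof (induction w arbitrary: k)
  case (Cons a w)
  then show ?case by (cases k) (simp_all add: algebra_simps)
qed simp

lemma word_wt_f:
  assumes "word_f i w = Some w'"
  shows "word_wt w' = word_wt w - simple_root i"
proof -
  from assms have *: "positions i w \<noteq> {}" "w ! pivot i w = i" "w' = w[pivot i w := i + 1/2]"
    by (auto simp: word_f_eq_Some_iff)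
  moreover from this have "pivot i w < length w"
    using pivot_in_positions positions_def by auto
  ultimately show ?thesis by (simp add: word_wt_update simple_root_def)
qed

text \<open>Since \<open>word_phi_plus_epsilon\<close> bounds the sum by 1, a value 1 of either
  function forces the other to vanish. For \<open>w'\<close> the value 1 comes from the inverse move
  \<open>word_e i w' = Some w\<close>.\<close>

lemma word_epsilon_phi_f:
  assumes "word_f i w = Some w'"
  shows "word_epsilon i w = 0" "word_phi i w = 1" "word_epsilon i w' = 1" "word_phi i w' = 0"
proof -
  show "word_phi i w = 1" using assms by (simp add: word_phi_def)
  then show "word_epsilon i w = 0"
    using word_phi_plus_epsilon[of i w] by (simp split: if_splits)
  show "word_epsilon i w' = 1" using assms by (simp add: word_epsilon_def word_f_iff_word_e)
  then show "word_phi i w' = 0"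
    using word_phi_plus_epsilon[of i w'] by (simp split: if_splits)
qed

lemma update_in_words: "w \<in> words \<Longrightarrow> c \<in> NN \<Longrightarrow> w[k := c] \<in> words"
  unfolding words_def using set_update_subset_insert by fastforce

lemma gl_crystal_words: "gl_crystal words word_wt word_epsilon word_phi word_e word_f"
proof
  fix w assume "w \<in> words"
  moreover have "Poly_Mapping.keys (word_wt w) \<subseteq> set w"
    by (auto simp: in_keys_iff lookup_word_wt count_list_0_iff)
  ultimately show "word_wt w \<in> weight_lattice"
    unfolding weight_lattice_def words_def by auto
next
  fix i w w' assume "i \<in> NN" "w \<in> words" "word_e i w = Some w'"
  then show "w' \<in> words" by (auto simp: word_e_eq_Some_iff update_in_words)
next
  fix i w w' assume "i \<in> NN" "w \<in> words" "word_f i w = Some w'"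
  then show "w' \<in> words" using NN_add_half(1) by (auto simp: word_f_eq_Some_iff update_in_words)
next
  fix i w assume "i \<in> NN"
  then show "word_phi i w + word_epsilon i w =
      (if weight_form (word_wt w) (simple_root i) \<noteq> 0 then 1 else 0)"
    by (simp add: weight_form_word_wt word_phi_plus_epsilon)
next
  fix i w w' assume "word_e i w = Some w'"
  \<comment> \<open>The axiom for \<open>e\<close> is the one for \<open>f\<close> with the roles of
    \<open>w\<close> and \<open>w'\<close> exchanged.\<close>
  then have "word_f i w' = Some w" by (simp add: word_f_iff_word_e)
  then show "int (word_epsilon i w') = int (word_epsilon i w) - 1 \<and>
      word_phi i w' = word_phi i w + 1 \<and> word_wt w' = word_wt w + simple_root i"
    by (simp add: word_epsilon_phi_f word_wt_f)
next
  fix i w w' assume "word_f i w = Some w'"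
  then show "word_epsilon i w' = word_epsilon i w + 1 \<and>
      int (word_phi i w') = int (word_phi i w) - 1 \<and> word_wt w' = word_wt w - simple_root i"
    by (simp add: word_epsilon_phi_f word_wt_f)
qed (rule word_f_iff_word_e)

section \<open>Transport of crystal structures\<close>

text \<open>The closure hypothesis ensures that \<open>the_inv_into\<close> is evaluated only on the
  image of \<open>p\<close>. This removes the inverse from all later arguments.\<close>

lemma pullback_op_eq_Some_iff:
  assumes "inj_on p B" "b \<in> B" "\<And>c. g (p b) = Some c \<Longrightarrow> c \<in> p ` B"
  shows "pullback_op B p g b = Some b' \<longleftrightarrow> b' \<in> B \<and> g (p b) = Some (p b')"
  using assms unfolding pullback_op_def
  by (auto simp: the_inv_into_f_f)

lemma gl_crystal_pullback:
  assumes C: "gl_crystal C wt \<epsilon> \<phi> e f"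
    and inj: "inj_on p B" and sub: "p ` B \<subseteq> C"
    and e: "\<And>i b c. i \<in> NN \<Longrightarrow> b \<in> B \<Longrightarrow> e i (p b) = Some c \<Longrightarrow> c \<in> p ` B"
    and f: "\<And>i b c. i \<in> NN \<Longrightarrow> b \<in> B \<Longrightarrow> f i (p b) = Some c \<Longrightarrow> c \<in> p ` B"
  shows "gl_crystal B (\<lambda>b. wt (p b)) (\<lambda>i b. \<epsilon> i (p b)) (\<lambda>i b. \<phi> i (p b))
    (\<lambda>i. pullback_op B p (e i)) (\<lambda>i. pullback_op B p (f i))"
proof -
  interpret C: gl_crystal C wt \<epsilon> \<phi> e f by (rule C)
  have pC: "p b \<in> C" if "b \<in> B" for b using sub that by blast
  have pe: "pullback_op B p (e i) b = Some b' \<longleftrightarrow> b' \<in> B \<and> e i (p b) = Some (p b')"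
    if "i \<in> NN" "b \<in> B" for i b b'
    by (rule pullback_op_eq_Some_iff[OF inj that(2) e[OF that]])
  have pf: "pullback_op B p (f i) b = Some b' \<longleftrightarrow> b' \<in> B \<and> f i (p b) = Some (p b')"
    if "i \<in> NN" "b \<in> B" for i b b'
    by (rule pullback_op_eq_Some_iff[OF inj that(2) f[OF that]])
  show ?thesis
  proof
    fix i b b' assume "i \<in> NN" "b \<in> B" "pullback_op B p (e i) b = Some b'"
    then show "int (\<epsilon> i (p b')) = int (\<epsilon> i (p b)) - 1 \<and> \<phi> i (p b') = \<phi> i (p b) + 1 \<and>
        wt (p b') = wt (p b) + simple_root i"
      using C.e_Some pC pe by blast
  next
    fix i b b' assume "i \<in> NN" "b \<in> B" "pullback_op B p (f i) b = Some b'"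
    then show "\<epsilon> i (p b') = \<epsilon> i (p b) + 1 \<and> int (\<phi> i (p b')) = int (\<phi> i (p b)) - 1 \<and>
        wt (p b') = wt (p b) - simple_root i"
      using C.f_Some pC pf by blast
  qed (simp_all add: pe pf pC C.wt_closed C.phi_plus_epsilon C.f_iff_e)
qed

section \<open>Enriched partitions\<close>

text \<open>A word records the values on \<open>X\<close>; outside \<open>X\<close> extensional
  functions agree.\<close>

lemma inj_on_psi:
  assumes "set xs = X" "F \<subseteq> X \<rightarrow>\<^sub>E Y"
  shows "inj_on (psi xs) F"
proof
  fix \<sigma> \<tau> assume "\<sigma> \<in> F" "\<tau> \<in> F" "psi xs \<sigma> = psi xs \<tau>"
  then have "\<sigma> \<in> X \<rightarrow>\<^sub>E Y" "\<tau> \<in> X \<rightarrow>\<^sub>E Y" "\<And>x. x \<in> X \<Longrightarrow> \<sigma> x = \<tau> x"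
    using assms by (auto simp: psi_def)
  then show "\<sigma> = \<tau>" by (rule PiE_ext)
qed

lemma psi_fun_upd:
  assumes "distinct xs" "k < length xs"
  shows "psi xs (\<sigma>(xs ! k := c)) = (psi xs \<sigma>)[k := c]"
  using assms unfolding psi_def
  by (intro nth_equalityI) (auto simp: nth_list_update nth_eq_iff_index_eq)

text \<open>Only relations involving \<open>x\<close> change. As \<open>c\<close> may be either
  value of the pair, one statement serves both \<open>e\<close> and \<open>f\<close>.\<close>

lemma enriched_partitions_fun_upd:
  assumes \<sigma>: "\<sigma> \<in> enriched_partitions X lt \<gamma>" and i: "i \<in> NN" and x: "x \<in> X"
    and irrefl: "irreflp_on X lt"
    and vals: "\<sigma> x \<in> {i, i + 1/2}" "c \<in> {i, i + 1/2}"
    and extremal: "\<And>y. \<lbrakk>y \<in> X; y \<noteq> x; \<sigma> y \<in> {i, i + 1/2}\<rbrakk> \<Longrightarrow>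
      if i \<in> even_letters then \<gamma> y < \<gamma> x else \<gamma> x < \<gamma> y"
  shows "\<sigma>(x := c) \<in> enriched_partitions X lt \<gamma>"
proof -
  note half = NN_add_half[OF i]
  have c: "c \<in> NN" using vals(2) i half by auto
  have \<sigma>_PiE: "\<sigma> \<in> X \<rightarrow>\<^sub>E NN" using \<sigma> unfolding enriched_partitions_def by simp
  then have NN: "\<sigma> y \<in> NN" if "y \<in> X" for y using that by auto
  have below: "\<sigma> y \<le> i" if "y \<in> X" "\<sigma> y < i + 1/2" for y
    using NN_less_imp_add_half_le[OF i NN[OF that(1)]] that(2) by linarith
  have above: "i + 1/2 \<le> \<sigma> y" if "y \<in> X" "i < \<sigma> y" for y
    using NN_less_imp_add_half_le[OF i NN[OF that(1)]] that(2) by linarith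
  define rel where "rel a b y z \<longleftrightarrow> a \<le> b \<and> (a = b \<and> a \<in> even_letters \<longrightarrow> \<gamma> y < \<gamma> z) \<and>
    (a = b \<and> a \<in> odd_letters \<longrightarrow> \<gamma> y > \<gamma> z)" for a b :: rat and y z
  have \<sigma>_rel: "rel (\<sigma> y) (\<sigma> z) y z" if "y \<in> X" "z \<in> X" "lt y z" for y z
    using \<sigma> that unfolding enriched_partitions_def rel_def by blast
  have "rel ((\<sigma>(x := c)) y) ((\<sigma>(x := c)) z) y z" if yz: "y \<in> X" "z \<in> X" "lt y z" for y z
  proof -
    have neq: "y \<noteq> z" using irrefl yz by (auto dest: irreflp_onD)
    consider "y = x" "z \<noteq> x" | "y \<noteq> x" "z = x" | "y \<noteq> x" "z \<noteq> x" using neq by blast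
    then show ?thesis
    proof cases
      case 1
      have xz: "rel (\<sigma> x) (\<sigma> z) x z" using \<sigma>_rel[OF yz] 1 by simp
      have "rel c (\<sigma> z) x z"
      proof (cases "\<sigma> z \<in> {i, i + 1/2}")
        case True
        with 1 yz have ext: "if i \<in> even_letters then \<gamma> z < \<gamma> x else \<gamma> x < \<gamma> z"
          by (intro extremal) auto
        \<comment> \<open>Otherwise \<open>\<sigma> x = i\<close> too, and the label condition at
          \<open>i\<close> contradicts the extremality of \<open>x\<close>. So a tie after the move
          can occur only at \<open>i + 1/2\<close>, where the opposite parity asks for exactly
          \<open>ext\<close>.\<close>
        have "\<sigma> z \<noteq> i"
          using xz ext vals(1) i unfolding rel_def odd_letters_eq by (auto split: if_splits)
        then have "\<sigma> z = i + 1/2" using True by simp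
        then show ?thesis using ext vals(2) half unfolding rel_def odd_letters_eq by auto
      next
        case False
        \<comment> \<open>Outside the pair, \<open>z\<close> has a value strictly above both choices
          of \<open>c\<close>, so the label conditions are vacuous.\<close>
        have "i \<le> \<sigma> z" using xz vals(1) unfolding rel_def by auto
        then have "i + 1/2 < \<sigma> z" using False above[OF yz(2)] by (simp add: less_le)
        then show ?thesis using vals(2) unfolding rel_def by auto
      qed
      then show ?thesis using 1 by simp
    next
      case 2
      have yx: "rel (\<sigma> y) (\<sigma> x) y x" using \<sigma>_rel[OF yz] 2 by simp
      have "rel (\<sigma> y) c y x"
      proof (cases "\<sigma> y \<in> {i, i + 1/2}")
        case True
        with 2 yz have ext: "if i \<in> even_letters then \<gamma> y < \<gamma> x else \<gamma> x < \<gamma> y"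
          by (intro extremal) auto
        \<comment> \<open>Dually, a tie at \<open>i + 1/2\<close> before the move is excluded, and a
          tie at \<open>i\<close> after it satisfies the label condition by
          \<open>ext\<close>.\<close>
        have "\<sigma> y \<noteq> i + 1/2"
          using yx ext vals(1) half unfolding rel_def odd_letters_eq by (auto split: if_splits)
        then have "\<sigma> y = i" using True by simp
        then show ?thesis using ext vals(2) unfolding rel_def odd_letters_eq by auto
      next
        case False
        have "\<sigma> y \<le> i + 1/2" using yx vals(1) unfolding rel_def by auto
        then have "\<sigma> y < i" using False below[OF yz(1)] by (simp add: less_le)
        then show ?thesis using vals(2) unfolding rel_def by auto
      qed
      then show ?thesis using 2 by simp
    next
      case 3
      then show ?thesis using \<sigma>_rel[OF yz] by simp
    qed
  qed
  moreover have "\<sigma>(x := c) \<in> X \<rightarrow>\<^sub>E NN"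
    using \<sigma>_PiE x c by (auto simp: PiE_def extensional_def)
  ultimately show ?thesis unfolding enriched_partitions_def rel_def by blast
qed

lemma psi_pivot_update_in_image:
  assumes irrefl: "irreflp_on X lt" and xs: "decreasing_arrangement X \<gamma> xs"
    and \<sigma>: "\<sigma> \<in> enriched_partitions X lt \<gamma>" and i: "i \<in> NN"
    and nonempty: "positions i (psi xs \<sigma>) \<noteq> {}" and c: "c \<in> {i, i + 1/2}"
  shows "(psi xs \<sigma>)[pivot i (psi xs \<sigma>) := c] \<in> psi xs ` enriched_partitions X lt \<gamma>"
proof -
  define k where "k = pivot i (psi xs \<sigma>)"
  have set_xs: "set xs = X" and sorted: "sorted_wrt (\<lambda>x y. \<gamma> x > \<gamma> y) xs"
    using xs unfolding decreasing_arrangement_def by simp_all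
  have decreasing: "\<gamma> (xs ! n) < \<gamma> (xs ! m)" if "m < n" "n < length xs" for m n
    using sorted_wrt_nth_less[OF sorted that] .
  \<comment> \<open>Strict decrease of labels excludes repetitions, so changing \<sigma> at one
    element changes a single letter of the word.\<close>
  have distinct: "distinct xs"
    unfolding distinct_conv_nth by (metis decreasing less_irrefl linorder_neqE_nat)
  have k: "k < length xs" "\<sigma> (xs ! k) \<in> {i, i + 1/2}"
    using pivot_in_positions[OF nonempty] unfolding k_def[symmetric]
    by (auto simp: positions_def psi_def)
  have "\<sigma>(xs ! k := c) \<in> enriched_partitions X lt \<gamma>"
  proof (rule enriched_partitions_fun_upd[OF \<sigma> i _ irrefl k(2) c])
    show "xs ! k \<in> X" using k set_xs by auto
    fix y assume y: "y \<in> X" "y \<noteq> xs ! k" "\<sigma> y \<in> {i, i + 1/2}"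
    then obtain m where m: "m < length xs" "y = xs ! m" using set_xs by (metis in_set_conv_nth)
    then have "m \<in> positions i (psi xs \<sigma>)" using y by (simp add: positions_def psi_def)
    \<comment> \<open>The inequality is strict because \<open>y\<close> differs from
      \<open>xs ! k\<close>, whence \<open>m\<close> differs from \<open>k\<close>;
      \<open>decreasing\<close> then reverses it into one between labels.\<close>
    from pivot_extremal[OF this] have "if i \<in> even_letters then k < m else m < k"
      using y m unfolding k_def[symmetric] by (auto simp: le_less)
    then show "if i \<in> even_letters then \<gamma> y < \<gamma> (xs ! k) else \<gamma> (xs ! k) < \<gamma> y"
      using decreasing m k by (simp split: if_splits)
  qed
  then have "psi xs (\<sigma>(xs ! k := c)) \<in> psi xs ` enriched_partitions X lt \<gamma>" by (rule imageI)
  then show ?thesis unfolding k_def[symmetric] psi_fun_upd[OF distinct k(1)] .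
qed

theorem theorem4p1:
  fixes X :: "'a set" and lt :: "'a \<Rightarrow> 'a \<Rightarrow> bool" and \<gamma> :: "'a \<Rightarrow> nat" and xs :: "'a list"
  assumes "labeled_poset X lt \<gamma>"
    and "decreasing_arrangement X \<gamma> xs"
  defines "EP \<equiv> enriched_partitions X lt \<gamma>"
    and "\<psi> \<equiv> psi xs"
  shows "inj_on \<psi> EP \<and> \<psi> ` EP \<subseteq> words \<and>
    (\<forall>i\<in>NN. \<forall>u \<in> insert None (Some ` \<psi> ` EP).
       Option.bind u (word_e i) \<in> insert None (Some ` \<psi> ` EP) \<and>
       Option.bind u (word_f i) \<in> insert None (Some ` \<psi> ` EP)) \<and>
    gl_crystal EP (\<lambda>\<sigma>. word_wt (\<psi> \<sigma>))
      (\<lambda>i \<sigma>. word_epsilon i (\<psi> \<sigma>)) (\<lambda>i \<sigma>. word_phi i (\<psi> \<sigma>))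
      (\<lambda>i. pullback_op EP \<psi> (word_e i)) (\<lambda>i. pullback_op EP \<psi> (word_f i))"
proof -
  have irrefl: "irreflp_on X lt" using assms(1) by (rule labeled_poset.irrefl)
  have set_xs: "set xs = X" using assms(2) unfolding decreasing_arrangement_def by simp
  have EP_PiE: "EP \<subseteq> X \<rightarrow>\<^sub>E NN" unfolding EP_def enriched_partitions_def by blast
  have inj: "inj_on \<psi> EP" unfolding \<psi>_def by (rule inj_on_psi[OF set_xs EP_PiE])
  have sub: "\<psi> ` EP \<subseteq> words"
    using EP_PiE set_xs unfolding \<psi>_def psi_def words_def by fastforce
  have update: "(\<psi> \<sigma>)[pivot i (\<psi> \<sigma>) := c] \<in> \<psi> ` EP"
    if "i \<in> NN" "\<sigma> \<in> EP" "positions i (\<psi> \<sigma>) \<noteq> {}" "c \<in> {i, i + 1/2}" for i \<sigma> c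
    using psi_pivot_update_in_image[OF irrefl assms(2)] that unfolding EP_def \<psi>_def by blast
  have e: "w \<in> \<psi> ` EP" if "i \<in> NN" "\<sigma> \<in> EP" "word_e i (\<psi> \<sigma>) = Some w" for i \<sigma> w
    using that update[OF that(1,2)] by (auto simp: word_e_eq_Some_iff)
  have f: "w \<in> \<psi> ` EP" if "i \<in> NN" "\<sigma> \<in> EP" "word_f i (\<psi> \<sigma>) = Some w" for i \<sigma> w
    using that update[OF that(1,2)] by (auto simp: word_f_eq_Some_iff)
  \<comment> \<open>\<open>Option.bind\<close> sends the formal zero to itself, so stability has to
    be checked only on words in the image.\<close>
  have "Option.bind u (g i) \<in> insert None (Some ` \<psi> ` EP)"
    if "u \<in> insert None (Some ` \<psi> ` EP)" "\<And>\<sigma> w. \<sigma> \<in> EP \<Longrightarrow> g i (\<psi> \<sigma>) = Some w \<Longrightarrow> w \<in> \<psi> ` EP"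
    for u i and g :: "rat \<Rightarrow> rat list \<Rightarrow> rat list option"
    using that by (cases "Option.bind u (g i)") (auto simp: bind_eq_Some_conv)
  then have "\<forall>i\<in>NN. \<forall>u \<in> insert None (Some ` \<psi> ` EP).
       Option.bind u (word_e i) \<in> insert None (Some ` \<psi> ` EP) \<and>
       Option.bind u (word_f i) \<in> insert None (Some ` \<psi> ` EP)"
    using e f by metis
  then show ?thesis
    using inj sub gl_crystal_pullback[OF gl_crystal_words inj sub e f] by (intro conjI)
qed

end
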